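(* (a) Let $M$ be a matroid on a finite set $V$ and let $N$ be a matroid on $\mathrm{Sym}_2(V)$. Then the following statements are equivalent (all properties of $N$ being with respect to $M$, with $k=2$): (1) $N$ satisfies the SP-rank Property and the Flat Property. (2) $N$ satisfies the Flat Property and Weak Order Multilinearity. (3) $N$ satisfies the Strong SP-rank Property and Weak Order Multilinearity. (4) $N$ satisfies the SP-rank Property, the Closure Property, and Weak Order Multilinearity. (b) There exist a finite set $V$, a matroid $M$ on $V$ and a matroid $N$ on $\mathrm{Sym}_2(V)$ such that $N$ satisfies the SP-rank Property and the Flat Property with respect to $M$, but does not satisfy Multilinearity with respect to $M$.
   Context: For a finite set $V$ and an integer $k\ge 0$, $\mathrm{Sym}_k(V)$ is the set of unordered $k$-words (multisets of size $k$) over $V$; $\mathrm{Sym}_0(V)=\{\emptyset\}$ (empty word) and $\mathrm{Sym}_1(V)=V$. For $\alpha\in\mathrm{Sym}_i(V)$, $\beta\in\mathrm{Sym}_j(V)$, $\alpha\cdot\beta\in\mathrm{Sym}_{i+j}(V)$ is the concatenation; $A\cdot B=\{\alpha\cdot\beta:\alpha\in A,\beta\in B\}$ and $\alpha\cdot B=\{\alpha\}\cdot B$. For a matroid $M$ on $V$: $r_M$ is the rank function, $\operatorname{rank}M=r_M(V)$, $\mathrm{cl}_M$ is the closure operator, $M^*$ is the dual, $L_M$ is the set of loops, $M|_X$ is the restriction to $X$. Weak order with relabelling: for matroids $M_1=(V_1,r_1)$, $M_2=(V_2,r_2)$ and a bijection $f:V_2\to V_1$, $M_1\preceq_{\rm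 w}M_2$ via $f$ means $r_1(f(X))\le r_2(X)$ for all $X\subseteq V_2$. Let $N$ be a matroid on $\mathrm{Sym}_k(V)$, $k\ge 1$. Properties of $N$ with respect to $M$: - SP-rank Property: $\operatorname{rank}N=\binom{\operatorname{rank}M+k-1}{k}$. - Strong SP-rank Property: for all $X\subseteq V$, $r_N(X\cdot\mathrm{Sym}_{k-1}(V))=\binom{\operatorname{rank}M+k-1}{k}-\binom{\operatorname{rank}M-r_M(X)+k-1}{k}$. - Flat Property: for every flat $F$ of $M$, $F\cdot\mathrm{Sym}_{k-1}(V)$ is a flat of $N$. - Closure Property: for all $X\subseteq V$, $\mathrm{cl}_M(X)\cdot\mathrm{Sym}_{k-1}(V)\subseteq\mathrm{cl}_N(X\cdot\mathrm{Sym}_{k-1}(V))$. - Multilinearity: for all $\tau\in\mathrm{Sym}_{k-1}(V\setminus L_M)$, $N|_{\tau\cdot V}$ is isomorphic to $M$ via $\tau\cdot v\mapsto v$; and $\tau\cdot v$ is a loop of $N$ for all $\tau\in\mathrm{Sym}_{k-1}(V)$, $v\in L_M$. - Weak Order Multilinearity: for all $\tau\in\mathrm{Sym}_{k-1}(V\setminus L_M)$, $M^*\preceq_{\rm w}(N|_{\tau\cdot V})^*$ via the bijection $\tau\cdot v\mapsto v$; and $\tau\cdot v$ is a loop of $N$ for all $\tau\in\mathrm{Sym}_{k-1}(V)$, $v\in L_M$. *)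

theory Defs
  imports "HOL-Library.Multiset" "HOL-Library.Set_Algebras"
begin

text \<open>A matroid is given by its ground set and its rank function; the values of the rank
  function outside the ground set are irrelevant.\<close>

record 'a pre_matroid =
  ground :: "'a set"
  rk :: "'a set \<Rightarrow> nat"

definition matroid :: "'a pre_matroid \<Rightarrow> bool" where
  "matroid M \<longleftrightarrow>
     finite (ground M) \<and>
     (\<forall>X. X \<subseteq> ground M \<longrightarrow> rk M X \<le> card X) \<and>
     (\<forall>X Y. X \<subseteq> Y \<longrightarrow> Y \<subseteq> ground M \<longrightarrow> rk M X \<le> rk M Y) \<and>
     (\<forall>X Y. X \<subseteq> ground M \<longrightarrow> Y \<subseteq> ground M \<longrightarrow>
        rk M (X \<union> Y) + rk M (X \<inter> Y) \<le> rk M X + rk M Y)"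

definition rank :: "'a pre_matroid \<Rightarrow> nat" where
  "rank M = rk M (ground M)"

definition cl :: "'a pre_matroid \<Rightarrow> 'a set \<Rightarrow> 'a set" where
  "cl M X = {e \<in> ground M. rk M (insert e X) = rk M X}"

definition flat :: "'a pre_matroid \<Rightarrow> 'a set \<Rightarrow> bool" where
  "flat M F \<longleftrightarrow> F \<subseteq> ground M \<and> cl M F = F"

definition loops :: "'a pre_matroid \<Rightarrow> 'a set" where
  "loops M = {e \<in> ground M. rk M {e} = 0}"

definition restriction :: "'a pre_matroid \<Rightarrow> 'a set \<Rightarrow> 'a pre_matroid" where
  "restriction M X = \<lparr>ground = X, rk = rk M\<rparr>"

text \<open>The corank formula \<open>r*(X) = |X| - r(V) + r(V - X)\<close>, ordered so that the subtraction
  on \<open>nat\<close> does not truncate: \<open>r(V) \<le> r(X) + r(V - X) \<le> |X| + r(V - X)\<close>.\<close>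

definition dual :: "'a pre_matroid \<Rightarrow> 'a pre_matroid" where
  "dual M = \<lparr>ground = ground M, rk = (\<lambda>X. card X + rk M (ground M - X) - rank M)\<rparr>"

definition isomorphic_via ::
    "('a \<Rightarrow> 'b) \<Rightarrow> 'a pre_matroid \<Rightarrow> 'b pre_matroid \<Rightarrow> bool" where
  "isomorphic_via f M1 M2 \<longleftrightarrow>
     bij_betw f (ground M1) (ground M2) \<and>
     (\<forall>X. X \<subseteq> ground M1 \<longrightarrow> rk M2 (f ` X) = rk M1 X)"

text \<open>\<open>weak_le_via f M1 M2\<close> is \<open>M1 \<preceq> M2\<close> in the weak order; the relabelling \<open>f\<close> goes from the
  ground set of \<open>M2\<close> to that of \<open>M1\<close>.\<close>

definition weak_le_via ::
    "('b \<Rightarrow> 'a) \<Rightarrow> 'a pre_matroid \<Rightarrow> 'b pre_matroid \<Rightarrow> bool" where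
  "weak_le_via f M1 M2 \<longleftrightarrow>
     bij_betw f (ground M2) (ground M1) \<and>
     (\<forall>X. X \<subseteq> ground M2 \<longrightarrow> rk M1 (f ` X) \<le> rk M2 X)"

text \<open>Unordered words are multisets and concatenation is multiset sum, so that the product
  \<open>A \<cdot> B\<close> of sets of words is the elementwise sum \<open>A + B\<close> of \<open>Set_Algebras\<close>.
  The identification of \<open>X\<close> with the set of words of length one over \<open>X\<close> is made explicit
  by writing \<open>Sym 1 X\<close>.\<close>

abbreviation Sym :: "nat \<Rightarrow> 'a set \<Rightarrow> 'a multiset set" where
  "Sym k V \<equiv> multisets_of_size V k"

text \<open>For \<open>w = \<tau> \<cdot> v\<close> with \<open>v \<in> V\<close>, \<open>last_letter V \<tau> w\<close> is \<open>v\<close>.\<close>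

definition last_letter :: "'a set \<Rightarrow> 'a multiset \<Rightarrow> 'a multiset \<Rightarrow> 'a" where
  "last_letter V \<tau> = inv_into V (\<lambda>v. \<tau> + {#v#})"

lemma last_letter_eq: "v \<in> V \<Longrightarrow> last_letter V \<tau> (\<tau> + {#v#}) = v"
  unfolding last_letter_def by (rule inv_into_f_f) (auto simp: inj_on_def)

lemma Sym_1: "Sym 1 V = (\<lambda>v. {#v#}) ` V"
proof -
  have "\<exists>v\<in>V. w = {#v#}" if "set_mset w \<subseteq> V" "size w = 1" for w
    using that by (auto dest!: size_1_singleton_mset simp del: One_nat_def)
  then show ?thesis by (auto simp: multisets_of_size_def)
qed

text \<open>The following properties are meant for \<open>k \<ge> 1\<close>. Under the matroid axioms the subtraction
  \<open>rank M - rk M X\<close> on \<open>nat\<close> does not truncate, as \<open>rk M\<close> is monotone.\<close>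

definition SP_rank :: "nat \<Rightarrow> 'a pre_matroid \<Rightarrow> 'a multiset pre_matroid \<Rightarrow> bool" where
  "SP_rank k M N \<longleftrightarrow> rank N = (rank M + k - 1) choose k"

definition strong_SP_rank :: "nat \<Rightarrow> 'a pre_matroid \<Rightarrow> 'a multiset pre_matroid \<Rightarrow> bool" where
  "strong_SP_rank k M N \<longleftrightarrow>
     (\<forall>X. X \<subseteq> ground M \<longrightarrow>
        int (rk N (Sym 1 X + Sym (k - 1) (ground M))) =
          int ((rank M + k - 1) choose k) - int ((rank M - rk M X + k - 1) choose k))"

definition flat_property :: "nat \<Rightarrow> 'a pre_matroid \<Rightarrow> 'a multiset pre_matroid \<Rightarrow> bool" where
  "flat_property k M N \<longleftrightarrow>
     (\<forall>F. flat M F \<longrightarrow> flat N (Sym 1 F + Sym (k - 1) (ground M)))"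

definition closure_property :: "nat \<Rightarrow> 'a pre_matroid \<Rightarrow> 'a multiset pre_matroid \<Rightarrow> bool" where
  "closure_property k M N \<longleftrightarrow>
     (\<forall>X. X \<subseteq> ground M \<longrightarrow>
        Sym 1 (cl M X) + Sym (k - 1) (ground M) \<subseteq> cl N (Sym 1 X + Sym (k - 1) (ground M)))"

definition multilinearity :: "nat \<Rightarrow> 'a pre_matroid \<Rightarrow> 'a multiset pre_matroid \<Rightarrow> bool" where
  "multilinearity k M N \<longleftrightarrow>
     (\<forall>\<tau> \<in> Sym (k - 1) (ground M - loops M).
        isomorphic_via (last_letter (ground M) \<tau>)
          (restriction N ({\<tau>} + Sym 1 (ground M))) M) \<and>
     (\<forall>\<tau> \<in> Sym (k - 1) (ground M). \<forall>v \<in> loops M. \<tau> + {#v#} \<in> loops N)"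

definition weak_order_multilinearity ::
    "nat \<Rightarrow> 'a pre_matroid \<Rightarrow> 'a multiset pre_matroid \<Rightarrow> bool" where
  "weak_order_multilinearity k M N \<longleftrightarrow>
     (\<forall>\<tau> \<in> Sym (k - 1) (ground M - loops M).
        weak_le_via (last_letter (ground M) \<tau>)
          (dual M) (dual (restriction N ({\<tau>} + Sym 1 (ground M))))) \<and>
     (\<forall>\<tau> \<in> Sym (k - 1) (ground M). \<forall>v \<in> loops M. \<tau> + {#v#} \<in> loops N)"

end

theory Submission
  imports Defs
begin

text \<open>Everything rests on \<open>h X = r_N (X \<cdot> V) + binom (rank M - r_M X + 1) 2\<close>, with
  \<open>h {} = binom (rank M + 1) 2\<close> and \<open>h V = rank N\<close>. The Flat Property makes \<open>h\<close> increasing: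
  adding a letter \<open>b\<close> outside the closure of \<open>X\<close> raises \<open>r_N (X \<cdot> V)\<close> by at least
  \<open>rank M - r_M X\<close>. The Closure Property and Weak Order Multilinearity make \<open>h\<close> decreasing, since
  \<open>b \<cdot> V\<close> then adds at most \<open>rank M - r_M X\<close> to \<open>b \<cdot> X\<close>. Constancy of \<open>h\<close> with value
  \<open>binom (rank M + 1) 2\<close> is the Strong SP-rank Property, and \<open>h {} = h V\<close> is the SP-rank
  Property, so a monotone \<open>h\<close> turns the latter into the former.\<close>

section \<open>Rank and closure in a matroid\<close>

lemma
  assumes "matroid M"
  shows matroid_finite: "finite (ground M)"
    and rk_le_card: "X \<subseteq> ground M \<Longrightarrow> rk M X \<le> card X"
    and rk_mono: "X \<subseteq> Y \<Longrightarrow> Y \<subseteq> ground M \<Longrightarrow> rk M X \<le> rk M Y"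
    and rk_submodular: "X \<subseteq> ground M \<Longrightarrow> Y \<subseteq> ground M \<Longrightarrow>
      rk M (X \<union> Y) + rk M (X \<inter> Y) \<le> rk M X + rk M Y"
  using assms unfolding matroid_def by blast+

lemma rk_empty: "matroid M \<Longrightarrow> rk M {} = 0"
  using rk_le_card[of M "{}"] by simp

lemma rk_insert_le:
  assumes "matroid M" "X \<subseteq> ground M" "e \<in> ground M"
  shows "rk M (insert e X) \<le> Suc (rk M X)"
  using rk_submodular[OF assms(1), of "{e}" X] rk_le_card[OF assms(1), of "{e}"] assms by simp

text \<open>Submodularity for \<open>Q\<close> and \<open>P \<union> R\<close>, whose intersection
  contains \<open>P\<close>. The gains are compared additively, so no subtraction on
  \<open>nat\<close> occurs.\<close>

lemma rk_diminishing_returns: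
  assumes "matroid M" "P \<subseteq> Q" "Q \<subseteq> ground M" "R \<subseteq> ground M"
  shows "rk M (Q \<union> R) + rk M P \<le> rk M Q + rk M (P \<union> R)"
proof -
  have "rk M (Q \<union> (P \<union> R)) + rk M (Q \<inter> (P \<union> R)) \<le> rk M Q + rk M (P \<union> R)"
    using assms by (intro rk_submodular) auto
  moreover have "rk M P \<le> rk M (Q \<inter> (P \<union> R))"
    using assms by (intro rk_mono) auto
  moreover have "Q \<union> (P \<union> R) = Q \<union> R" using assms by auto
  ultimately show ?thesis by simp
qed

lemma rk_insert_notin_cl:
  assumes M: "matroid M" and X: "X \<subseteq> ground M" and e: "e \<in> ground M" "e \<notin> cl M X"
  shows "rk M (insert e X) = Suc (rk M X)"
proof -
  have "rk M X \<le> rk M (insert e X)" using M X e(1) by (intro rk_mono) auto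
  with rk_insert_le[OF M X e(1)] e show ?thesis by (simp add: cl_def)
qed

lemma rk_insert_notin_cl_superset:
  assumes M: "matroid M" and "P \<subseteq> Q" and Q: "Q \<subseteq> ground M" and e: "e \<in> ground M" "e \<notin> cl M Q"
  shows "rk M (insert e P) = Suc (rk M P)"
  using rk_diminishing_returns[OF M \<open>P \<subseteq> Q\<close> Q, of "{e}"] rk_insert_notin_cl[OF M Q e]
    rk_insert_le[OF M _ e(1), of P] assms(2-4) by simp

lemma cl_subset_ground: "cl M X \<subseteq> ground M"
  by (auto simp: cl_def)

lemma subset_cl: "X \<subseteq> ground M \<Longrightarrow> X \<subseteq> cl M X"
  by (auto simp: cl_def insert_absorb)

lemma cl_mono:
  assumes "matroid M" "X \<subseteq> Y" "Y \<subseteq> ground M"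
  shows "cl M X \<subseteq> cl M Y"
proof
  fix e assume e: "e \<in> cl M X"
  then have "e \<in> ground M" and "rk M (insert e X) = rk M X" by (auto simp: cl_def)
  with rk_insert_notin_cl_superset[OF assms, of e] show "e \<in> cl M Y" by fastforce
qed

lemma rk_Un_subset_cl:
  assumes M: "matroid M" and X: "X \<subseteq> ground M" and Y: "Y \<subseteq> cl M X"
  shows "rk M (X \<union> Y) = rk M X"
proof -
  have "finite Y" using Y cl_subset_ground matroid_finite[OF M] by (metis finite_subset)
  then show ?thesis using Y
  proof (induction Y rule: finite_induct)
    case (insert e Y)
    have e: "e \<in> ground M" and sub: "X \<union> Y \<subseteq> ground M"
      using insert.prems X cl_subset_ground[of M X] by auto
    have "e \<in> cl M (X \<union> Y)"
      using cl_mono[OF M, of X "X \<union> Y"] insert.prems sub by auto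
    then show ?case using insert by (simp add: cl_def)
  qed simp
qed

lemma rk_cl:
  assumes "matroid M" "X \<subseteq> ground M"
  shows "rk M (cl M X) = rk M X"
  using rk_Un_subset_cl[OF assms order_refl] subset_cl[OF assms(2)] by (simp add: Un_absorb1)

lemma rk_subset_cl:
  assumes "matroid M" "X \<subseteq> ground M" "Y \<subseteq> cl M X"
  shows "rk M Y \<le> rk M X"
  using rk_mono[OF assms(1,3) cl_subset_ground] rk_cl[OF assms(1,2)] by simp

lemma flat_cl:
  assumes M: "matroid M" and X: "X \<subseteq> ground M"
  shows "flat M (cl M X)"
proof -
  have "e \<in> cl M X" if "e \<in> cl M (cl M X)" for e
  proof (rule ccontr)
    assume e: "e \<notin> cl M X"
    have eg: "e \<in> ground M" using that by (simp add: cl_def)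
    have "Suc (rk M X) = rk M (insert e X)" using rk_insert_notin_cl[OF M X eg e] by simp
    also have "\<dots> \<le> rk M (insert e (cl M X))"
      using eg cl_subset_ground[of M X] subset_cl[OF X] by (intro rk_mono[OF M]) auto
    also have "\<dots> = rk M X" using that rk_cl[OF M X] by (simp add: cl_def)
    finally show False by simp
  qed
  with subset_cl[OF cl_subset_ground, of M X] show ?thesis
    unfolding flat_def using cl_subset_ground[of M X] by auto
qed

lemma cl_subset_flat:
  assumes "matroid M" "flat M F" "X \<subseteq> F"
  shows "cl M X \<subseteq> F"
  using cl_mono[OF assms(1,3)] assms(2) by (auto simp: flat_def)

lemma loops_eq_cl: "matroid M \<Longrightarrow> loops M = cl M {}"
  by (auto simp: loops_def cl_def rk_empty)

text \<open>Growth from \<open>X\<close> to \<open>Y\<close> one element at a time. All intermediate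
  sets stay inside \<open>Y\<close>, so conditions such as avoiding \<open>cl M Y\<close> pass down
  to them.\<close>

lemma subset_ground_induct [consumes 2, case_names base step]:
  assumes "finite Y" "X \<subseteq> Y"
    and "P X"
    and "\<And>Z e. X \<subseteq> Z \<Longrightarrow> insert e Z \<subseteq> Y \<Longrightarrow> P Z \<Longrightarrow> P (insert e Z)"
  shows "P Y"
proof -
  have "finite D \<Longrightarrow> X \<union> D \<subseteq> Y \<Longrightarrow> P (X \<union> D)" for D
    by (induction D rule: finite_induct) (use assms(3,4) in auto)
  from this[of Y] assms(1,2) show ?thesis by (simp add: Un_absorb1)
qed

section \<open>Words of length two\<close>

text \<open>\<open>word_row u X\<close> is u \<cdot> X and \<open>word_star V X\<close> is X \<cdot>
  V; for k = 2 the properties become statements about these two kinds of sets.\<close>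

definition word_row :: "'a \<Rightarrow> 'a set \<Rightarrow> 'a multiset set" where
  "word_row u X = (\<lambda>v. {#u, v#}) ` X"

definition word_star :: "'a set \<Rightarrow> 'a set \<Rightarrow> 'a multiset set" where
  "word_star V X = {{#x, v#} |x v. x \<in> X \<and> v \<in> V}"

lemma Sym_2: "Sym 2 V = word_star V V"
proof -
  have "\<exists>x v. w = {#x, v#} \<and> x \<in> V \<and> v \<in> V" if "set_mset w \<subseteq> V" "size w = 2" for w
  proof -
    obtain x w' where w: "w = add_mset x w'" "size w' = 1"
      using \<open>size w = 2\<close> by (metis Suc_1 size_eq_Suc_imp_eq_union diff_Suc_1 size_add_mset One_nat_def Suc_inject)
    then obtain v where "w' = {#v#}" using size_1_singleton_mset by metis
    with w that(1) show ?thesis by auto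
  qed
  then show ?thesis by (auto simp: multisets_of_size_def word_star_def)
qed

lemma Sym_1_plus: "Sym 1 X + Sym 1 V = word_star V X"
  unfolding Sym_1 word_star_def set_plus_def
  by (auto simp: image_iff) (metis add_mset_add_single add_mset_commute union_mset_add_mset_left empty_neutral(1))+

lemma singleton_plus_Sym_1: "{{#u#}} + Sym 1 X = word_row u X"
  unfolding Sym_1 word_row_def set_plus_def
  by (auto simp: image_iff add_mset_commute)

text \<open>Words are unordered, so either letter may come from \<open>X\<close>. A word with both
  letters outside a flat therefore avoids its star, which is how flats of \<open>N\<close> get
  used.\<close>

lemma pair_in_word_star:
  "{#x, v#} \<in> word_star V X \<longleftrightarrow> x \<in> X \<and> v \<in> V \<or> v \<in> X \<and> x \<in> V"
  unfolding word_star_def by (auto simp: add_eq_conv_ex)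

lemma word_row_subset_star: "u \<in> V \<Longrightarrow> word_row u X \<subseteq> word_star V X"
  by (auto simp: word_row_def pair_in_word_star)

lemma word_star_insert: "word_star V (insert b X) = word_star V X \<union> word_row b V"
  by (auto simp: word_star_def word_row_def)

lemma word_star_mono: "X \<subseteq> Y \<Longrightarrow> word_star V X \<subseteq> word_star V Y"
  by (auto simp: word_star_def)

lemma word_row_insert: "word_row b (insert v X) = insert {#b, v#} (word_row b X)"
  by (auto simp: word_row_def)

lemma word_row_mono: "X \<subseteq> Y \<Longrightarrow> word_row b X \<subseteq> word_row b Y"
  by (auto simp: word_row_def)

lemma word_star_empty [simp]: "word_star V {} = {}"
  by (auto simp: word_star_def)

lemma word_row_empty [simp]: "word_row b {} = {}"
  by (auto simp: word_row_def)

lemma last_letter_word_row: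
  assumes "X \<subseteq> V"
  shows "last_letter V {#u#} ` word_row u X = X"
proof -
  have "last_letter V {#u#} {#u, v#} = v" if "v \<in> X" for v
    using last_letter_eq[of v V "{#u#}"] that assms by (simp add: add_mset_commute subset_iff)
  then show ?thesis by (force simp: word_row_def image_image)
qed

lemma ball_Sym_1: "(\<forall>\<tau> \<in> Sym 1 X. P \<tau>) \<longleftrightarrow> (\<forall>u \<in> X. P {#u#})"
  unfolding Sym_1 by blast

lemma inj_word_row: "inj (\<lambda>v. {#u, v#})"
  by (auto simp: inj_on_def)

lemma card_word_row: "card (word_row u X) = card X"
  unfolding word_row_def by (rule card_image) (metis inj_word_row inj_on_subset subset_UNIV)

lemma word_row_Diff: "word_row u X - word_row u Y = word_row u (X - Y)"
  unfolding word_row_def by (simp add: image_set_diff inj_word_row)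

lemma subset_word_row: "Z \<subseteq> word_row u X \<longleftrightarrow> (\<exists>Y \<subseteq> X. Z = word_row u Y)"
  unfolding word_row_def by (simp add: subset_image_iff)

lemma bij_betw_last_letter: "bij_betw (last_letter V {#u#}) (word_row u V) V"
proof (rule bij_betwI')
  show "(last_letter V {#u#} x = last_letter V {#u#} y) = (x = y)"
    if "x \<in> word_row u V" "y \<in> word_row u V" for x y
    using that last_letter_eq[of _ V "{#u#}"] by (auto simp: word_row_def add_mset_commute)
qed (use last_letter_word_row[of V V u] in blast)+

section \<open>The properties for words of length two\<close>

locale sym2_matroid =
  fixes M :: "'a pre_matroid" and N :: "'a multiset pre_matroid"
  assumes M: "matroid M" and N: "matroid N" and ground_N: "ground N = Sym 2 (ground M)"
begin

abbreviation "V \<equiv> ground M"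
abbreviation "r \<equiv> rk M"
abbreviation "\<rho> \<equiv> rk N"
abbreviation "star \<equiv> word_star V"

text \<open>The corank that the Strong SP-rank Property predicts for \<open>star X\<close>; adding
  it to the rank of \<open>star X\<close> gives \<open>h X\<close>.\<close>

abbreviation defect :: "'a set \<Rightarrow> nat" where
  "defect X \<equiv> Suc (rank M - r X) choose 2"

lemma star_subset: "X \<subseteq> V \<Longrightarrow> star X \<subseteq> ground N"
  using word_star_mono[of X V V] by (simp add: ground_N Sym_2)

lemma row_subset: "u \<in> V \<Longrightarrow> X \<subseteq> V \<Longrightarrow> word_row u X \<subseteq> ground N"
  using word_row_subset_star[of u V X] star_subset[of X] by blast

lemma finite_V: "finite V"
  by (rule matroid_finite[OF M])

lemma r_le_rank: "X \<subseteq> V \<Longrightarrow> r X \<le> rank M"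
  unfolding rank_def by (rule rk_mono[OF M]) auto

lemma star_V: "\<rho> (star V) = rank N"
  by (simp add: rank_def ground_N Sym_2)

lemma SP_rank_iff: "SP_rank 2 M N \<longleftrightarrow> rank N = (Suc (rank M) choose 2)"
  by (simp add: SP_rank_def numeral_2_eq_2)

lemma strong_SP_rank_iff:
  "strong_SP_rank 2 M N \<longleftrightarrow> (\<forall>X \<subseteq> V. \<rho> (star X) + defect X = (Suc (rank M) choose 2))"
proof -
  have "2 - 1 = (1::nat)" "\<And>n::nat. n + 2 - 1 = Suc n" by auto
  then show ?thesis unfolding strong_SP_rank_def
    by (simp only: Sym_1_plus) (auto simp: algebra_simps simp flip: of_nat_add)
qed

lemma flat_property_iff: "flat_property 2 M N \<longleftrightarrow> (\<forall>F. flat M F \<longrightarrow> flat N (star F))"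
proof -
  have "2 - 1 = (1::nat)" by auto
  then show ?thesis unfolding flat_property_def by (simp only: Sym_1_plus)
qed

lemma closure_property_iff:
  "closure_property 2 M N \<longleftrightarrow> (\<forall>X \<subseteq> V. star (cl M X) \<subseteq> cl N (star X))"
proof -
  have "2 - 1 = (1::nat)" by auto
  then show ?thesis unfolding closure_property_def by (simp only: Sym_1_plus)
qed

text \<open>In the corank formula the cardinalities cancel, and \<open>Y\<close> is the complement
  of the set in the dual. The result says that passing from u \<cdot> Y to u \<cdot> V gains at most
  \<open>rank M - r Y\<close>.\<close>

lemma weak_le_row_iff:
  assumes u: "u \<in> V"
  shows "weak_le_via (last_letter V {#u#}) (dual M) (dual (restriction N (word_row u V))) \<longleftrightarrow>
    (\<forall>Y \<subseteq> V. \<rho> (word_row u V) + r Y \<le> \<rho> (word_row u Y) + rank M)"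
    (is "?L \<longleftrightarrow> ?R")
proof -
  have "?L \<longleftrightarrow> (\<forall>X \<subseteq> V. card X + r (V - X) - rank M \<le>
      card X + \<rho> (word_row u (V - X)) - \<rho> (word_row u V))"
  proof -
    have "(\<forall>Z \<subseteq> word_row u V. P Z) \<longleftrightarrow> (\<forall>X \<subseteq> V. P (word_row u X))" for P
      unfolding subset_word_row by blast
    then show ?thesis
      unfolding weak_le_via_def dual_def restriction_def rank_def
      by (simp add: bij_betw_last_letter last_letter_word_row card_word_row word_row_Diff)
  qed
  also have "\<dots> \<longleftrightarrow> (\<forall>X \<subseteq> V. \<rho> (word_row u V) + r (V - X) \<le> \<rho> (word_row u (V - X)) + rank M)"
  proof (intro all_cong1 imp_cong refl)
    fix X assume X: "X \<subseteq> V"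
    \<comment> \<open>Neither corank truncates, so both subtractions can be moved across the
      inequality.\<close>
    have "rank M \<le> card X + r (V - X)"
      using rk_submodular[OF M, of X "V - X"] rk_le_card[OF M X] X
      by (simp add: rank_def Un_absorb1)
    moreover have "\<rho> (word_row u V) \<le> card X + \<rho> (word_row u (V - X))"
    proof -
      have "word_row u V = word_row u X \<union> word_row u (V - X)"
        using X by (auto simp: word_row_def)
      then show ?thesis
        using rk_submodular[OF N row_subset[OF u X] row_subset[OF u, of "V - X"]]
          rk_le_card[OF N row_subset[OF u X]] by (simp add: card_word_row)
    qed
    ultimately show "(card X + r (V - X) - rank M \<le>
        card X + \<rho> (word_row u (V - X)) - \<rho> (word_row u V)) \<longleftrightarrow>
      \<rho> (word_row u V) + r (V - X) \<le> \<rho> (word_row u (V - X)) + rank M" by linarith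
  qed
  also have "\<dots> \<longleftrightarrow> ?R" by (metis Diff_subset double_diff order_refl)
  finally show ?thesis .
qed

lemma weak_order_multilinearity_iff:
  "weak_order_multilinearity 2 M N \<longleftrightarrow>
    (\<forall>u \<in> V - loops M. \<forall>Y \<subseteq> V. \<rho> (word_row u V) + r Y \<le> \<rho> (word_row u Y) + rank M) \<and>
    (\<forall>v \<in> loops M. \<forall>u \<in> V. {#v, u#} \<in> loops N)"
proof -
  have "2 - 1 = (1::nat)" by auto
  then show ?thesis
    unfolding weak_order_multilinearity_def
    by (simp only: ball_Sym_1 singleton_plus_Sym_1) (auto simp: weak_le_row_iff)
qed

lemma weak_order_rowD:
  assumes "weak_order_multilinearity 2 M N" "u \<in> V" "u \<notin> loops M" "Y \<subseteq> V"
  shows "\<rho> (word_row u V) + r Y \<le> \<rho> (word_row u Y) + rank M"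
  using assms by (simp add: weak_order_multilinearity_iff)

section \<open>Row growth under the Flat Property\<close>

lemma flat_new_word:
  assumes flat: "flat_property 2 M N" and J: "J \<subseteq> V" and b: "b \<in> V" "b \<notin> cl M J"
    and v: "v \<in> V" "v \<notin> cl M J" and P: "P \<subseteq> star J"
  shows "\<rho> (insert {#b, v#} P) = Suc (\<rho> P)"
\<comment> \<open>The comparison set is the flat \<open>star (cl M J)\<close> of \<open>N\<close>:
  it contains \<open>P\<close> but not the new word, since both letters avoid
  \<open>cl M J\<close>.\<close>
proof (rule rk_insert_notin_cl_superset[OF N])
  show "P \<subseteq> star (cl M J)" using P word_star_mono[OF subset_cl[OF J], of V] by blast
  show "star (cl M J) \<subseteq> ground N" by (rule star_subset[OF cl_subset_ground])
  show "{#b, v#} \<in> ground N" using b v by (simp add: ground_N Sym_2 pair_in_word_star)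
  have "cl N (star (cl M J)) = star (cl M J)"
    using flat flat_cl[OF M J] by (simp add: flat_property_iff flat_def)
  then show "{#b, v#} \<notin> cl N (star (cl M J))" using b v by (simp add: pair_in_word_star)
qed

text \<open>The letters of \<open>X\<close> are multiplied with \<open>b\<close> in an order in which the letter whose addition
  makes \<open>b\<close> dependent comes last: up to then \<open>b\<close> avoids the flat spanned by the letters used so
  far, and every letter that raises the rank gives a word outside the corresponding flat of
  \<open>N\<close>.\<close>

lemma flat_row_growth:
  assumes flat: "flat_property 2 M N" and X: "F \<subseteq> X" "X \<subseteq> V" and b: "b \<in> V" "b \<notin> cl M F"
    and P: "P \<subseteq> star F"
  shows "\<rho> (P \<union> word_row b F) + r X \<le> \<rho> (P \<union> word_row b X) + r F"
proof -
  have sub: "P \<union> word_row b J \<subseteq> star J" if "F \<subseteq> J" for J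
    using P word_star_mono[OF that, of V] word_row_subset_star[OF b(1)] by fastforce
  have sub_ground: "P \<union> word_row b J \<subseteq> ground N" if "F \<subseteq> J" "J \<subseteq> V" for J
    using sub[OF that(1)] star_subset[OF that(2)] by blast
  have new: "\<rho> (P \<union> word_row b (insert v J)) = Suc (\<rho> (P \<union> word_row b J))"
    if "F \<subseteq> J" "J \<subseteq> V" "b \<notin> cl M J" "v \<in> V" "v \<notin> cl M J" for J v
    using flat_new_word[OF flat that(2) b(1) that(3-5) sub[OF that(1)]]
    by (simp add: word_row_insert)
  have avoiding: "\<rho> (P \<union> word_row b F) + r J \<le> \<rho> (P \<union> word_row b J) + r F"
    if J: "F \<subseteq> J" "J \<subseteq> V" "b \<notin> cl M J" for J
    using finite_subset[OF J(2) finite_V] J(1)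
  proof (induction J rule: subset_ground_induct)
    case (step Z e)
    have Z: "Z \<subseteq> V" "e \<in> V" using step J by auto
    have bZ: "b \<notin> cl M Z" using cl_mono[OF M, of Z J] step J by auto
    show ?case
    proof (cases "e \<in> cl M Z")
      case True
      have "\<rho> (P \<union> word_row b Z) \<le> \<rho> (P \<union> word_row b (insert e Z))"
        using step Z word_row_mono[of Z "insert e Z" b]
        by (intro rk_mono[OF N] sub_ground) auto
      with True step.IH show ?thesis by (simp add: cl_def)
    next
      case False
      with step.IH new[OF \<open>F \<subseteq> Z\<close> Z(1) bZ Z(2)] rk_insert_le[OF M Z] show ?thesis by simp
    qed
  qed simp
  \<comment> \<open>A maximal \<open>J\<close> in \<open>S\<close> carries all the growth available
    while \<open>b\<close> stays independent of the letters used.\<close>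
  define S where "S = {J. F \<subseteq> J \<and> J \<subseteq> X \<and> b \<notin> cl M J}"
  have "finite S"
    using finite_subset[OF X(2) finite_V] by (auto simp: S_def intro: finite_subset[of _ "Pow X"])
  moreover have "S \<noteq> {}" using X b by (auto simp: S_def)
  ultimately obtain J where "J \<in> S" and max: "\<And>J'. J' \<in> S \<Longrightarrow> J \<subseteq> J' \<Longrightarrow> J = J'"
    using finite_has_maximal[of S] by metis
  then have J: "F \<subseteq> J" "J \<subseteq> X" "b \<notin> cl M J" by (auto simp: S_def)
  have JV: "J \<subseteq> V" using J X by blast
  show ?thesis
  proof (cases "J = X")
    case True
    with avoiding J JV show ?thesis by blast
  next
    case False
    \<comment> \<open>By maximality \<open>x\<close> brings \<open>b\<close> into the closure, and
      exchange puts \<open>x\<close> into the closure of \<open>insert b J\<close>. Hence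
      \<open>X\<close> exceeds \<open>J\<close> in rank by at most one.\<close>
    have x: "r (insert x J) = Suc (r J) \<and> x \<in> cl M (insert b J)" if "x \<in> X - J" for x
    proof -
      have xV: "x \<in> V" using that X by auto
      have "b \<in> cl M (insert x J)" using max[of "insert x J"] that J by (auto simp: S_def)
      then have "r (insert b (insert x J)) = r (insert x J)" by (simp add: cl_def)
      moreover have "r (insert b J) = Suc (r J)"
        using rk_insert_notin_cl[OF M JV b(1)] J by blast
      moreover have "r (insert b J) \<le> r (insert b (insert x J))"
        using JV b xV by (intro rk_mono[OF M]) auto
      moreover have "r (insert x J) \<le> Suc (r J)" using rk_insert_le[OF M JV xV] .
      ultimately show ?thesis using xV by (simp add: cl_def insert_commute)
    qed
    obtain x where xJ: "x \<in> X - J" using False J by blast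
    have xV: "x \<in> V" using xJ X by auto
    have "X \<subseteq> cl M (insert b J)"
      using x subset_cl[of "insert b J" M] JV b by blast
    then have "r X \<le> r (insert b J)"
      using JV b by (intro rk_subset_cl[OF M]) auto
    also have "\<dots> = Suc (r J)" using rk_insert_notin_cl[OF M JV b(1)] J by blast
    finally have "r X \<le> Suc (r J)" .
    \<comment> \<open>One more letter supplies the missing unit: \<open>b\<close> still avoids
      \<open>cl M J\<close> when its word with \<open>x\<close> is added.\<close>
    moreover have "x \<notin> cl M J" using x[OF xJ] by (simp add: cl_def)
    then have "\<rho> (P \<union> word_row b (insert x J)) = Suc (\<rho> (P \<union> word_row b J))"
      using new J JV xV by blast
    moreover have "\<rho> (P \<union> word_row b (insert x J)) \<le> \<rho> (P \<union> word_row b X)"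
      using xJ X J word_row_mono[of "insert x J" X b]
      by (intro rk_mono[OF N] sub_ground) auto
    moreover have "\<rho> (P \<union> word_row b F) + r J \<le> \<rho> (P \<union> word_row b J) + r F"
      using avoiding J JV by blast
    ultimately show ?thesis by linarith
  qed
qed

text \<open>Growth from the empty set, where avoiding the closure means not being a loop.\<close>

lemma flat_row_rank_ge:
  assumes "flat_property 2 M N" "X \<subseteq> V" "b \<in> V" "b \<notin> loops M"
  shows "r X \<le> \<rho> (word_row b X)"
  using flat_row_growth[OF assms(1) _ assms(2,3), of "{}" "{}"] assms(4)
  by (simp add: loops_eq_cl[OF M] rk_empty[OF M] rk_empty[OF N])

section \<open>Monotonicity of \<open>h\<close> in both directions\<close>

lemma defect_insert:
  assumes "X \<subseteq> V" "b \<in> V" "b \<notin> cl M X"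
  shows "defect X = defect (insert b X) + (rank M - r X)"
proof -
  have "r (insert b X) = Suc (r X)" using rk_insert_notin_cl[OF M assms] .
  moreover have "r (insert b X) \<le> rank M" using assms by (intro r_le_rank) auto
  \<comment> \<open>Pascal's rule: binom (s + 2) 2 = binom (s + 1) 2 + (s + 1).\<close>
  ultimately obtain s where "rank M - r X = Suc s" "rank M - r (insert b X) = s"
    by (metis Suc_diff_le diff_Suc_Suc)
  then show ?thesis by (simp add: numeral_2_eq_2)
qed

lemma flat_defect_mono:
  assumes flat: "flat_property 2 M N" and XY: "X \<subseteq> Y" "Y \<subseteq> V"
  shows "\<rho> (star X) + defect X \<le> \<rho> (star Y) + defect Y"
  using finite_subset[OF XY(2) finite_V] XY(1)
proof (induction Y rule: subset_ground_induct)
  case (step Z b)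
  have Z: "Z \<subseteq> V" "b \<in> V" using step XY by auto
  have "\<rho> (star Z) + defect Z \<le> \<rho> (star (insert b Z)) + defect (insert b Z)"
  proof (cases "b \<in> cl M Z")
    case True
    have "\<rho> (star Z) \<le> \<rho> (star (insert b Z))"
      using Z by (intro rk_mono[OF N] star_subset word_star_mono) auto
    with True show ?thesis by (simp add: cl_def)
  next
    case False
    \<comment> \<open>With \<open>P = star Z\<close> the words of b \<cdot> Z are already present,
      so the whole growth of the row is gained over \<open>star Z\<close> and balances the drop in
      \<open>defect\<close>.\<close>
    have "\<rho> (star Z \<union> word_row b Z) + rank M \<le> \<rho> (star Z \<union> word_row b V) + r Z"
      using flat_row_growth[OF flat Z(1) order_refl Z(2) False order_refl] by (simp add: rank_def)
    moreover have "star Z \<union> word_row b Z = star Z"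
      using word_row_subset_star[OF Z(2), of Z] by blast
    ultimately show ?thesis
      using defect_insert[OF Z False] r_le_rank[OF Z(1)] by (simp add: word_star_insert)
  qed
  with step.IH show ?case by simp
qed simp

lemma closure_defect_antimono:
  assumes clos: "closure_property 2 M N" and wom: "weak_order_multilinearity 2 M N"
    and XY: "X \<subseteq> Y" "Y \<subseteq> V"
  shows "\<rho> (star Y) + defect Y \<le> \<rho> (star X) + defect X"
  using finite_subset[OF XY(2) finite_V] XY(1)
proof (induction Y rule: subset_ground_induct)
  case (step Z b)
  have Z: "Z \<subseteq> V" "b \<in> V" using step XY by auto
  have "\<rho> (star (insert b Z)) + defect (insert b Z) \<le> \<rho> (star Z) + defect Z"
  proof (cases "b \<in> cl M Z")
    case True
    have "star (insert b Z) \<subseteq> star (cl M Z)"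
      using True subset_cl[OF Z(1)] by (intro word_star_mono) auto
    then have "\<rho> (star (insert b Z)) \<le> \<rho> (star Z)"
      using clos Z(1) by (intro rk_subset_cl[OF N star_subset]) (auto simp: closure_property_iff)
    with True show ?thesis by (simp add: cl_def)
  next
    case False
    then have "b \<notin> loops M" using cl_mono[OF M _ Z(1), of "{}"] by (auto simp: loops_eq_cl[OF M])
    from weak_order_rowD[OF wom Z(2) this Z(1)]
    have "\<rho> (word_row b V) + r Z \<le> \<rho> (word_row b Z) + rank M" .
    \<comment> \<open>Since b \<cdot> Z lies in \<open>star Z\<close>, adding b \<cdot> V gains no
      more over \<open>star Z\<close> than over b \<cdot> Z.\<close>
    moreover have "\<rho> (star Z \<union> word_row b V) + \<rho> (word_row b Z) \<le>
        \<rho> (star Z) + \<rho> (word_row b Z \<union> word_row b V)"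
      using Z by (intro rk_diminishing_returns[OF N] word_row_subset_star star_subset row_subset) auto
    moreover have "word_row b Z \<union> word_row b V = word_row b V"
      using word_row_mono[OF Z(1), of b] by blast
    ultimately show ?thesis
      using defect_insert[OF Z False] r_le_rank[OF Z(1)] by (simp add: word_star_insert)
  qed
  with step.IH show ?case by simp
qed simp

lemma defect_empty: "\<rho> (star {}) + defect {} = (Suc (rank M) choose 2)"
  by (simp add: rk_empty[OF M] rk_empty[OF N])

lemma defect_ground: "\<rho> (star V) + defect V = rank N"
  using star_V by (simp add: rank_def)

section \<open>The implications\<close>

lemma SP_flat_imp_strong_SP:
  assumes "SP_rank 2 M N" "flat_property 2 M N"
  shows "strong_SP_rank 2 M N"
  unfolding strong_SP_rank_iff
proof (intro allI impI)
  fix X assume X: "X \<subseteq> V"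
  show "\<rho> (star X) + defect X = (Suc (rank M) choose 2)"
    using flat_defect_mono[OF assms(2), of "{}" X] flat_defect_mono[OF assms(2) X order_refl] X
      assms(1) defect_empty defect_ground
    by (simp add: SP_rank_iff)
qed

lemma strong_SP_imp_SP: "strong_SP_rank 2 M N \<Longrightarrow> SP_rank 2 M N"
  using defect_ground by (simp add: strong_SP_rank_iff SP_rank_iff)

text \<open>\<open>X\<close> and \<open>cl M X\<close> have the same rank, hence the same
  \<open>defect\<close>, so their stars have equal rank and every word between them is
  spanned.\<close>

lemma strong_SP_imp_closure:
  assumes "strong_SP_rank 2 M N"
  shows "closure_property 2 M N"
  unfolding closure_property_iff
proof (intro allI impI subsetI)
  fix X w assume X: "X \<subseteq> V" and w: "w \<in> star (cl M X)"
  have sub: "star (cl M X) \<subseteq> ground N" by (rule star_subset[OF cl_subset_ground])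
  have "\<rho> (star (cl M X)) + defect (cl M X) = \<rho> (star X) + defect X"
    using assms X cl_subset_ground[of M X] by (simp add: strong_SP_rank_iff)
  then have "\<rho> (star (cl M X)) = \<rho> (star X)" by (simp add: rk_cl[OF M X])
  moreover have "\<rho> (star X) \<le> \<rho> (insert w (star X))"
    using w sub star_subset[OF X] by (intro rk_mono[OF N]) auto
  moreover have "\<rho> (insert w (star X)) \<le> \<rho> (star (cl M X))"
    using w sub word_star_mono[OF subset_cl[OF X], of V] by (intro rk_mono[OF N]) auto
  ultimately show "w \<in> cl N (star X)" using w sub by (auto simp: cl_def)
qed

text \<open>The Strong SP-rank Property for a single letter fixes the rank of its row:
  \<open>rank M\<close> for a nonloop, 0 for a loop. Row growth bounds u \<cdot> Y from below by
  \<open>r Y\<close>.\<close>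

lemma SP_flat_imp_weak_order:
  assumes SP: "SP_rank 2 M N" and flat: "flat_property 2 M N"
  shows "weak_order_multilinearity 2 M N"
  unfolding weak_order_multilinearity_iff
proof (intro conjI ballI allI impI)
  have strong: "\<rho> (star X) + defect X = (Suc (rank M) choose 2)" if "X \<subseteq> V" for X
    using SP_flat_imp_strong_SP[OF assms] that by (simp add: strong_SP_rank_iff)
  fix u Y assume u: "u \<in> V - loops M" and Y: "Y \<subseteq> V"
  have "u \<notin> cl M {}" using u by (simp add: loops_eq_cl[OF M])
  then have "defect {} = defect {u} + rank M"
    using defect_insert[of "{}" u] u by (simp add: rk_empty[OF M])
  moreover have "\<rho> (star {u}) + defect {u} = defect {}"
    using strong[of "{u}"] u by (simp add: rk_empty[OF M])
  ultimately have "\<rho> (word_row u V) = rank M" by (simp add: word_star_insert)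
  with flat_row_rank_ge[OF flat Y, of u] u
  show "\<rho> (word_row u V) + r Y \<le> \<rho> (word_row u Y) + rank M" by simp
next
  fix v u assume v: "v \<in> loops M" and u: "u \<in> V"
  have vV: "v \<in> V" using v by (simp add: loops_def)
  have "\<rho> (star {v}) + defect {v} = (Suc (rank M) choose 2)"
    using SP_flat_imp_strong_SP[OF assms] vV unfolding strong_SP_rank_iff by blast
  then have "\<rho> (star {v}) = 0" using v by (simp add: loops_def)
  moreover have mem: "{#v, u#} \<in> star {v}" using u by (simp add: pair_in_word_star)
  moreover have "star {v} \<subseteq> ground N" using star_subset[of "{v}"] vV by simp
  moreover from mem this have "\<rho> {{#v, u#}} \<le> \<rho> (star {v})" by (intro rk_mono[OF N]) auto
  ultimately show "{#v, u#} \<in> loops N" by (auto simp: loops_def)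
qed

text \<open>If \<open>u\<close> and \<open>v\<close> both avoid the flat \<open>F\<close>, then \<open>u \<cdot> V\<close> raises the rank of \<open>F \<cdot> V\<close> by
  \<open>rank M - r F\<close>; were \<open>u \<cdot> v\<close> in the closure of \<open>F \<cdot> V\<close>, weak order multilinearity for
  \<open>F \<union> {v}\<close> would allow one less.\<close>

lemma strong_SP_weak_order_imp_flat:
  assumes strong: "strong_SP_rank 2 M N" and wom: "weak_order_multilinearity 2 M N"
  shows "flat_property 2 M N"
  unfolding flat_property_iff
proof (intro allI impI)
  fix F assume F: "flat M F"
  then have FV: "F \<subseteq> V" and clF: "cl M F = F" by (auto simp: flat_def)
  have "w \<in> star F" if w: "w \<in> cl N (star F)" for w
  proof (rule ccontr)
    assume "w \<notin> star F"
    obtain u v where uv: "w = {#u, v#}" "u \<in> V" "v \<in> V"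
      using w cl_subset_ground[of N "star F"] by (auto simp: ground_N Sym_2 word_star_def)
    with \<open>w \<notin> star F\<close> have nF: "u \<notin> F" "v \<notin> F" by (auto simp: pair_in_word_star)
    have "u \<notin> loops M" using cl_subset_flat[OF M F, of "{}"] nF by (auto simp: loops_eq_cl[OF M])
    have vFV: "insert v F \<subseteq> V" using uv FV by auto
    have r: "r (insert v F) = Suc (r F)"
      using rk_insert_notin_cl[OF M FV uv(3)] nF clF by simp
    \<comment> \<open>The word \<open>w\<close> puts all of u \<cdot> (F \<union> {v}) into the set
      to which u \<cdot> V is added.\<close>
    have span: "\<rho> (insert w (star F) \<union> word_row u V) + \<rho> (word_row u (insert v F))
        \<le> \<rho> (insert w (star F)) + \<rho> (word_row u (insert v F) \<union> word_row u V)"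
      using uv FV row_subset[of u V] star_subset[OF FV] word_row_subset_star[OF uv(2), of F]
        row_subset[OF uv(2) vFV]
      by (intro rk_diminishing_returns[OF N]) (auto simp: word_row_insert)
    have "word_row u (insert v F) \<union> word_row u V = word_row u V"
      using word_row_mono[OF vFV, of u] by blast
    moreover have "insert w (star F) \<union> word_row u V = star (insert u F)"
      using uv by (auto simp: word_star_insert word_row_def)
    ultimately have "\<rho> (star (insert u F)) + \<rho> (word_row u (insert v F))
        \<le> \<rho> (insert w (star F)) + \<rho> (word_row u V)"
      using span by simp
    moreover have "\<rho> (word_row u V) + r (insert v F) \<le> \<rho> (word_row u (insert v F)) + rank M"
      by (rule weak_order_rowD[OF wom uv(2) \<open>u \<notin> loops M\<close> vFV])
    moreover have "\<rho> (insert w (star F)) = \<rho> (star F)" using w by (simp add: cl_def)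
    moreover have "\<rho> (star (insert u F)) + defect (insert u F) = \<rho> (star F) + defect F"
      using strong FV uv by (simp add: strong_SP_rank_iff)
    moreover have "defect F = defect (insert u F) + (rank M - r F)"
      using defect_insert[OF FV uv(2)] nF clF by simp
    \<comment> \<open>The rank bound for \<open>insert v F\<close> makes \<open>rank M - r F\<close>
      positive, so being one short is a contradiction.\<close>
    ultimately show False using r r_le_rank[OF vFV] by linarith
  qed
  then show "flat N (star F)"
    using star_subset[OF FV] subset_cl[OF star_subset[OF FV]] by (auto simp: flat_def)
qed

text \<open>Growing \<open>X\<close> to \<open>V\<close>, the row \<open>v \<cdot> V\<close> gains at least \<open>rank M - r X\<close> over \<open>v \<cdot> cl X\<close>, while
  its rank is at most \<open>rank M\<close>.\<close>

lemma flat_weak_order_row_closure: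
  assumes flat: "flat_property 2 M N" and wom: "weak_order_multilinearity 2 M N"
    and X: "X \<subseteq> V" and v: "v \<in> V" "v \<notin> cl M X" and x: "x \<in> cl M X"
  shows "{#v, x#} \<in> cl N (word_row v X)"
proof -
  have nl: "v \<notin> loops M" using cl_mono[OF M _ X, of "{}"] v by (auto simp: loops_eq_cl[OF M])
  have xV: "x \<in> V" using x cl_subset_ground[of M X] by auto
  then have sub: "insert x X \<subseteq> V" using X by auto
  have "v \<notin> cl M (insert x X)"
  proof -
    have "cl M (insert x X) \<subseteq> cl M X"
      using cl_subset_flat[OF M flat_cl[OF M X], of "insert x X"] x subset_cl[OF X] by auto
    with v show ?thesis by blast
  qed
  then have "\<rho> (word_row v (insert x X)) + rank M \<le> \<rho> (word_row v V) + r (insert x X)"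
    using flat_row_growth[OF flat sub order_refl v(1), of "{}"] by (simp add: rank_def)
  moreover have "\<rho> (word_row v V) \<le> rank M"
    using weak_order_rowD[OF wom v(1) nl, of "{}"] by (simp add: rk_empty[OF M] rk_empty[OF N])
  moreover have "r (insert x X) = r X" using x by (simp add: cl_def)
  moreover have "r X \<le> \<rho> (word_row v X)" by (rule flat_row_rank_ge[OF flat X v(1) nl])
  moreover have "\<rho> (word_row v X) \<le> \<rho> (word_row v (insert x X))"
    using row_subset[OF v(1) sub] by (intro rk_mono[OF N] word_row_mono) auto
  \<comment> \<open>The rank of v \<cdot> (X \<union> {x}) is at most \<open>r X\<close>, which is
    at most that of v \<cdot> X.\<close>
  ultimately have "\<rho> (insert {#v, x#} (word_row v X)) = \<rho> (word_row v X)"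
    by (simp add: word_row_insert)
  then show ?thesis
    using v xV by (simp add: cl_def ground_N Sym_2 pair_in_word_star)
qed

text \<open>For \<open>x\<close> and \<open>v\<close> both in the closure of \<open>X\<close> the word \<open>x \<cdot> v\<close> need not be spanned by
  \<open>v \<cdot> X\<close>. But \<open>v \<cdot> V\<close> is spanned by \<open>v \<cdot> (X \<union> (V - cl X))\<close>, and for \<open>w\<close> outside the closure
  \<open>v \<cdot> w\<close> is spanned by \<open>w \<cdot> X\<close>.\<close>

lemma flat_weak_order_imp_closure:
  assumes flat: "flat_property 2 M N" and wom: "weak_order_multilinearity 2 M N"
  shows "closure_property 2 M N"
  unfolding closure_property_iff
proof (intro allI impI subsetI)
  fix X w assume X: "X \<subseteq> V" and "w \<in> star (cl M X)"
  then obtain x v where "w = {#x, v#}" and x: "x \<in> cl M X" and v: "v \<in> V"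
    unfolding word_star_def by blast
  then have w: "w = {#v, x#}" by (simp add: add_mset_commute)
  have starX: "star X \<subseteq> ground N" by (rule star_subset[OF X])
  have xV: "x \<in> V" using x cl_subset_ground[of M X] by auto
  have outside: "{#y, z#} \<in> cl N (star X)" if "y \<in> V" "y \<notin> cl M X" "z \<in> cl M X" for y z
    using flat_weak_order_row_closure[OF flat wom X that]
      cl_mono[OF N word_row_subset_star[OF that(1), of X] starX] by blast
  show "w \<in> cl N (star X)"
  proof (cases "v \<in> loops M \<or> v \<notin> cl M X")
    case True
    then show ?thesis
    proof
      assume "v \<in> loops M"
      then have "{#v, x#} \<in> loops N" using wom xV by (auto simp: weak_order_multilinearity_iff)
      then show ?thesis
        using cl_mono[OF N _ starX, of "{}"] w by (auto simp: loops_eq_cl[OF N])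
    qed (use outside v x w in blast)
  next
    case False
    \<comment> \<open>\<open>Y\<close> still spans \<open>V\<close>, so v \<cdot> Y already has rank
      at least \<open>rank M\<close>, the most that v \<cdot> V can have.\<close>
    define Y where "Y = X \<union> (V - cl M X)"
    have Y: "Y \<subseteq> V" using X by (auto simp: Y_def)
    have V: "V \<subseteq> cl M Y"
      using cl_mono[OF M _ Y, of X] subset_cl[OF Y] by (auto simp: Y_def)
    have "rank M \<le> r Y" unfolding rank_def by (rule rk_subset_cl[OF M Y V])
    also have "\<dots> \<le> \<rho> (word_row v Y)" using flat_row_rank_ge[OF flat Y v] False by blast
    finally have *: "rank M \<le> \<rho> (word_row v Y)" .
    have "\<rho> (insert w (word_row v Y)) \<le> \<rho> (word_row v V)"
      using w xV row_subset[OF v, of V] word_row_mono[OF Y, of v]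
      by (intro rk_mono[OF N]) (auto simp: word_row_def)
    also have "\<dots> \<le> rank M"
      using weak_order_rowD[OF wom v, of "{}"] False
      by (simp add: rk_empty[OF M] rk_empty[OF N])
    finally have "\<rho> (insert w (word_row v Y)) \<le> \<rho> (word_row v Y)" using * by simp
    moreover have wN: "w \<in> ground N" using w v xV by (simp add: ground_N Sym_2 pair_in_word_star)
    moreover have "\<rho> (word_row v Y) \<le> \<rho> (insert w (word_row v Y))"
      using wN row_subset[OF v Y] by (intro rk_mono[OF N]) auto
    ultimately have "w \<in> cl N (word_row v Y)" by (simp add: cl_def)
    also have "cl N (word_row v Y) \<subseteq> cl N (star X)"
    proof (rule cl_subset_flat[OF N flat_cl[OF N starX]])
      have "{#v, y#} \<in> cl N (star X)" if "y \<in> Y" for y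
      proof (cases "y \<in> X")
        case True
        then have "{#v, y#} \<in> star X" using v by (simp add: pair_in_word_star)
        with subset_cl[OF starX] show ?thesis by blast
      next
        \<comment> \<open>Here \<open>y\<close> is outside \<open>cl M X\<close> and
          \<open>v\<close> inside, so \<open>outside\<close> applies to the word read as y \<cdot>
          v.\<close>
        case False
        with that \<open>\<not> (v \<in> loops M \<or> v \<notin> cl M X)\<close> outside[of y v] show ?thesis
          by (auto simp: Y_def add_mset_commute)
      qed
      then show "word_row v Y \<subseteq> cl N (star X)" by (auto simp: word_row_def)
    qed
    finally show ?thesis .
  qed
qed

text \<open>The Closure Property has just been derived, so \<open>h\<close> is monotone both ways
  and its values at {} and \<open>V\<close> agree.\<close>

lemma flat_weak_order_imp_SP:
  assumes "flat_property 2 M N" "weak_order_multilinearity 2 M N"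
  shows "SP_rank 2 M N"
  using closure_defect_antimono[OF flat_weak_order_imp_closure[OF assms] assms(2), of "{}" V]
    flat_defect_mono[OF assms(1), of "{}" V] defect_empty defect_ground
  by (simp add: SP_rank_iff)

lemma SP_closure_weak_order_imp_strong_SP:
  assumes "SP_rank 2 M N" "closure_property 2 M N" "weak_order_multilinearity 2 M N"
  shows "strong_SP_rank 2 M N"
  unfolding strong_SP_rank_iff
proof (intro allI impI)
  fix X assume X: "X \<subseteq> V"
  show "\<rho> (star X) + defect X = (Suc (rank M) choose 2)"
    using closure_defect_antimono[OF assms(2,3), of "{}" X]
      closure_defect_antimono[OF assms(2,3) X order_refl] X
      assms(1) defect_empty defect_ground
    by (simp add: SP_rank_iff)
qed

lemma equivalences:
  "((SP_rank 2 M N \<and> flat_property 2 M N) \<longleftrightarrow>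
      (flat_property 2 M N \<and> weak_order_multilinearity 2 M N)) \<and>
   ((SP_rank 2 M N \<and> flat_property 2 M N) \<longleftrightarrow>
      (strong_SP_rank 2 M N \<and> weak_order_multilinearity 2 M N)) \<and>
   ((SP_rank 2 M N \<and> flat_property 2 M N) \<longleftrightarrow>
      (SP_rank 2 M N \<and> closure_property 2 M N \<and> weak_order_multilinearity 2 M N))"
  using SP_flat_imp_strong_SP strong_SP_imp_SP strong_SP_imp_closure SP_flat_imp_weak_order
    strong_SP_weak_order_imp_flat flat_weak_order_imp_SP SP_closure_weak_order_imp_strong_SP
  by blast

end

section \<open>A matroid satisfying the Flat Property but not Multilinearity\<close>

text \<open>The image of an intersection lies in the intersection of the images. Truncation is
  harmless because the count is monotone: once \<open>X\<close> or \<open>Y\<close> reaches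
  \<open>k\<close>, so does the union.\<close>

lemma truncated_card_image_submodular:
  assumes "finite X" "finite Y"
  shows "min k (card (f ` (X \<union> Y))) + min k (card (f ` (X \<inter> Y)))
    \<le> min k (card (f ` X)) + min k (card (f ` Y))"
proof -
  have "card (f ` (X \<union> Y)) + card (f ` X \<inter> f ` Y) = card (f ` X) + card (f ` Y)"
    using card_Un_Int[of "f ` X" "f ` Y"] assms by (simp add: image_Un)
  moreover have "card (f ` (X \<inter> Y)) \<le> card (f ` X \<inter> f ` Y)"
    using assms by (intro card_mono) auto
  moreover have "card (f ` X) \<le> card (f ` (X \<union> Y))" "card (f ` Y) \<le> card (f ` (X \<union> Y))"
    using assms by (auto intro!: card_mono)
  ultimately show ?thesis by linarith
qed

text \<open>The elements of \<open>C\<close> are coloops; the others form a partition matroid on the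
  fibres of \<open>f\<close>, truncated to rank \<open>k\<close>.\<close>

lemma matroid_truncated_partition_coloops:
  assumes "finite E"
  shows "matroid \<lparr>ground = E, rk = \<lambda>X. min k (card (f ` (X - C))) + card (X \<inter> C)\<rparr>"
  unfolding matroid_def pre_matroid.simps
proof (intro conjI allI impI)
  fix X Y assume X: "X \<subseteq> E" and Y: "Y \<subseteq> E"
  have fin: "finite X" "finite Y" using X Y \<open>finite E\<close> by (auto intro: finite_subset)
  have "card ((X \<union> Y) \<inter> C) + card (X \<inter> Y \<inter> C) = card (X \<inter> C) + card (Y \<inter> C)"
    using card_Un_Int[of "X \<inter> C" "Y \<inter> C"] fin by (simp add: Int_Un_distrib Int_ac)
  moreover have "min k (card (f ` (X \<union> Y - C))) + min k (card (f ` (X \<inter> Y - C)))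
      \<le> min k (card (f ` (X - C))) + min k (card (f ` (Y - C)))"
  proof -
    have "X \<union> Y - C = (X - C) \<union> (Y - C)" "X \<inter> Y - C = (X - C) \<inter> (Y - C)" by auto
    then show ?thesis using truncated_card_image_submodular[of "X - C" "Y - C" k f] fin by simp
  qed
  ultimately show "min k (card (f ` (X \<union> Y - C))) + card ((X \<union> Y) \<inter> C) +
      (min k (card (f ` (X \<inter> Y - C))) + card (X \<inter> Y \<inter> C))
    \<le> min k (card (f ` (X - C))) + card (X \<inter> C) + (min k (card (f ` (Y - C))) + card (Y \<inter> C))"
    by linarith
next
  fix X assume "X \<subseteq> E"
  then have fin: "finite X" using \<open>finite E\<close> by (rule finite_subset)
  have "card (X - C) + card (X \<inter> C) = card X"
    using fin by (metis card_Diff_subset_Int card_mono finite_Int inf_le1 le_add_diff_inverse2)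
  moreover have "card (f ` (X - C)) \<le> card (X - C)" using fin by (intro card_image_le) auto
  ultimately show "min k (card (f ` (X - C))) + card (X \<inter> C) \<le> card X" by linarith
next
  fix X Y assume "X \<subseteq> Y" "Y \<subseteq> E"
  then have "finite Y" using \<open>finite E\<close> by (blast intro: finite_subset)
  then show "min k (card (f ` (X - C))) + card (X \<inter> C) \<le> min k (card (f ` (Y - C))) + card (Y \<inter> C)"
    using \<open>X \<subseteq> Y\<close> by (intro add_mono min.mono order_refl card_mono) auto
qed (rule assms)

text \<open>The classes are {0, 1} and {2}. The empty set of coloops is spelled out so that the rank
  function is an instance of \<open>matroid_truncated_partition_coloops\<close>.\<close>

definition parallel_matroid :: "nat pre_matroid" where
  "parallel_matroid =
    \<lparr>ground = {0, 1, 2}, rk = \<lambda>X. min 2 (card ((\<lambda>x. x = 2) ` (X - {}))) + card (X \<inter> {})\<rparr>"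

text \<open>The word \<open>22\<close> is a coloop, and the other words form a line with the three parallel classes
  \<open>{00}\<close>, \<open>{01, 11}\<close> and \<open>{02, 12}\<close>. The letters \<open>0\<close> and \<open>1\<close> are parallel in
  \<open>parallel_matroid\<close>, but \<open>00\<close> and \<open>01\<close> are not.\<close>

definition word_class :: "nat multiset \<Rightarrow> nat" where
  "word_class w = (if 2 \<in># w then 2 else if 1 \<in># w then 1 else 0)"

definition parallel_product :: "nat multiset pre_matroid" where
  "parallel_product =
    \<lparr>ground = Sym 2 {0, 1, 2},
     rk = \<lambda>X. min 2 (card (word_class ` (X - {{#2, 2#}}))) + card (X \<inter> {{#2, 2#}})\<rparr>"

lemma ground_parallel_matroid: "ground parallel_matroid = {0, 1, 2}"
  by (simp add: parallel_matroid_def)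

lemma ground_parallel_product: "ground parallel_product = Sym 2 {0, 1, 2}"
  by (simp add: parallel_product_def)

lemma Sym_2_three: "Sym 2 {0, 1, 2 :: nat} =
    {{#0, 0#}, {#0, 1#}, {#1, 1#}, {#0, 2#}, {#1, 2#}, {#2, 2#}}"
  unfolding Sym_2 word_star_def by (auto simp: add_mset_commute)

lemma rk_parallel_product_simps:
  "word_class {#0, 0#} = 0" "word_class {#0, 1#} = 1" "word_class {#1, 1#} = 1"
  "word_class {#0, 2#} = 2" "word_class {#1, 2#} = 2"
  "{#0, 0#} \<noteq> {#2, 2 :: nat#}" "{#0, 1#} \<noteq> {#2, 2 :: nat#}" "{#1, 1#} \<noteq> {#2, 2 :: nat#}"
  "{#0, 2#} \<noteq> {#2, 2 :: nat#}" "{#1, 2#} \<noteq> {#2, 2 :: nat#}"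
  "rk parallel_product X =
    min 2 (card (word_class ` (X - {{#2, 2#}}))) + card (X \<inter> {{#2, 2#}})"
  by (auto simp: word_class_def parallel_product_def add_eq_conv_ex)

lemma matroid_parallel_matroid: "matroid parallel_matroid"
  unfolding parallel_matroid_def by (rule matroid_truncated_partition_coloops) simp

lemma matroid_parallel_product: "matroid parallel_product"
  unfolding parallel_product_def
  by (rule matroid_truncated_partition_coloops) (simp add: Sym_2_three del: One_nat_def)

interpretation parallel: sym2_matroid parallel_matroid parallel_product
  by unfold_locales
    (use matroid_parallel_matroid matroid_parallel_product in
      \<open>simp_all add: parallel_matroid_def parallel_product_def\<close>)

lemma parallel_flats:
  assumes "flat parallel_matroid F"
  shows "F \<in> {{}, {0, 1}, {2}, {0, 1, 2}}"
proof -
  have F: "F \<subseteq> {0, 1, 2}" and cl: "cl parallel_matroid F = F"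
    using assms by (auto simp: flat_def parallel_matroid_def)
  \<comment> \<open>Once one of the parallel letters is in \<open>F\<close>, its class is counted
    and the other adds no rank.\<close>
  have image: "insert False ((\<lambda>x. x = 2) ` F) = (\<lambda>x. x = 2) ` F" if "0 \<in> F \<or> 1 \<in> F"
    using that by force
  have "0 \<in> F \<longleftrightarrow> 1 \<in> F"
  proof -
    have "1 \<in> cl parallel_matroid F" if "0 \<in> F"
      using that image by (simp add: cl_def parallel_matroid_def)
    moreover have "0 \<in> cl parallel_matroid F" if "1 \<in> F"
      using that image by (simp add: cl_def parallel_matroid_def)
    ultimately show ?thesis using cl by auto
  qed
  with F have "F = {x \<in> {0, 1, 2}. x = 2 \<and> 2 \<in> F \<or> x \<noteq> 2 \<and> 0 \<in> F}" by auto
  then show ?thesis by (cases "2 \<in> F"; cases "0 \<in> F") auto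
qed

lemma flatI:
  assumes "F \<subseteq> ground M" "\<And>e. e \<in> ground M \<Longrightarrow> e \<notin> F \<Longrightarrow> rk M (insert e F) \<noteq> rk M F"
  shows "flat M F"
  using assms subset_cl[of F M] by (auto simp: flat_def cl_def)

text \<open>The star of {0, 1} is the whole line, that is, everything but the coloop; the star of
  {2} is the class {02, 12} together with the coloop.\<close>

lemma parallel_flat_property: "flat_property 2 parallel_matroid parallel_product"
  unfolding parallel.flat_property_iff
proof (intro allI impI)
  have "word_star {0, 1, 2} {0, 1} = {{#0, 0#}, {#0, 1#}, {#1, 1#}, {#0, 2#}, {#1, 2 :: nat#}}"
    "word_star {0, 1, 2} {2} = {{#0, 2#}, {#1, 2#}, {#2, 2 :: nat#}}"
    by (auto simp: word_star_def add_mset_commute)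
  note stars = this
  fix F assume "flat parallel_matroid F"
  then consider "F = {}" | "F = {0, 1}" | "F = {2}" | "F = {0, 1, 2}"
    using parallel_flats by blast
  then show "flat parallel_product (word_star (ground parallel_matroid) F)"
  proof cases
    case 1
    then show ?thesis
      by (intro flatI) (auto simp: ground_parallel_product Sym_2_three rk_parallel_product_simps insert_Diff_if Int_insert_left
        simp del: One_nat_def)
  next
    case 2
    then show ?thesis unfolding ground_parallel_matroid 2 stars
      by (intro flatI) (auto simp: ground_parallel_product Sym_2_three rk_parallel_product_simps insert_Diff_if Int_insert_left
        simp del: One_nat_def)
  next
    case 3
    then show ?thesis unfolding ground_parallel_matroid 3 stars
      by (intro flatI) (auto simp: ground_parallel_product Sym_2_three rk_parallel_product_simps insert_Diff_if Int_insert_left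
        simp del: One_nat_def)
  next
    case 4
    then show ?thesis unfolding ground_parallel_matroid 4 by (intro flatI) (auto simp: ground_parallel_product Sym_2)
  qed
qed

lemma parallel_SP_rank: "SP_rank 2 parallel_matroid parallel_product"
proof -
  have "rank parallel_matroid = 2" by (simp add: rank_def parallel_matroid_def)
  \<comment> \<open>The line contributes 2 and the coloop 1, matching binom 3 2.\<close>
  moreover have "rank parallel_product = 3"
    by (simp add: rank_def ground_parallel_product Sym_2_three rk_parallel_product_simps insert_Diff_if
        Int_insert_left del: One_nat_def)
  ultimately show ?thesis by (simp add: SP_rank_def choose_two)
qed

lemma parallel_not_multilinear: "\<not> multilinearity 2 parallel_matroid parallel_product"
proof
  let ?V = "ground parallel_matroid"
  assume "multilinearity 2 parallel_matroid parallel_product"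
  moreover have "2 - 1 = (1::nat)" by simp
  moreover have "0 \<in> ?V - loops parallel_matroid" by (simp add: parallel_matroid_def loops_def)
  ultimately have "isomorphic_via (last_letter ?V {#0#})
      (restriction parallel_product (word_row 0 ?V)) parallel_matroid"
    unfolding multilinearity_def by (simp only: ball_Sym_1 singleton_plus_Sym_1)
  \<comment> \<open>The words 00 and 01 have rank 2 together, while their last letters have rank
    1.\<close>
  moreover have "word_row 0 {0, 1} \<subseteq> word_row 0 ?V" by (rule word_row_mono) (simp add: ground_parallel_matroid)
  ultimately have "rk parallel_matroid (last_letter ?V {#0#} ` word_row 0 {0, 1}) =
      rk parallel_product (word_row 0 {0, 1})"
    by (simp add: isomorphic_via_def restriction_def)
  then show False
    by (simp add: last_letter_word_row ground_parallel_matroid del: One_nat_def)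
      (simp add: parallel_matroid_def word_row_def rk_parallel_product_simps
        insert_Diff_if Int_insert_left del: One_nat_def)
qed

theorem theorem2p2:
  shows "(\<forall>(M :: 'a pre_matroid) (N :: 'a multiset pre_matroid).
      matroid M \<longrightarrow> matroid N \<longrightarrow> ground N = Sym 2 (ground M) \<longrightarrow>
        ((SP_rank 2 M N \<and> flat_property 2 M N) \<longleftrightarrow>
           (flat_property 2 M N \<and> weak_order_multilinearity 2 M N)) \<and>
        ((SP_rank 2 M N \<and> flat_property 2 M N) \<longleftrightarrow>
           (strong_SP_rank 2 M N \<and> weak_order_multilinearity 2 M N)) \<and>
        ((SP_rank 2 M N \<and> flat_property 2 M N) \<longleftrightarrow>
           (SP_rank 2 M N \<and> closure_property 2 M N \<and> weak_order_multilinearity 2 M N)))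
    \<and> (\<exists>(M :: nat pre_matroid) (N :: nat multiset pre_matroid).
      matroid M \<and> matroid N \<and> ground N = Sym 2 (ground M) \<and>
      SP_rank 2 M N \<and> flat_property 2 M N \<and> \<not> multilinearity 2 M N)"
proof (intro conjI[of "\<forall>M N. P M N" for P] allI impI)
  fix M :: "'a pre_matroid" and N :: "'a multiset pre_matroid"
  assume "matroid M" "matroid N" "ground N = Sym 2 (ground M)"
  then interpret sym2_matroid M N by unfold_locales
  show "((SP_rank 2 M N \<and> flat_property 2 M N) \<longleftrightarrow>
           (flat_property 2 M N \<and> weak_order_multilinearity 2 M N)) \<and>
        ((SP_rank 2 M N \<and> flat_property 2 M N) \<longleftrightarrow>
           (strong_SP_rank 2 M N \<and> weak_order_multilinearity 2 M N)) \<and>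
        ((SP_rank 2 M N \<and> flat_property 2 M N) \<longleftrightarrow>
           (SP_rank 2 M N \<and> closure_property 2 M N \<and> weak_order_multilinearity 2 M N))"
    by (rule equivalences)
next
  show "\<exists>(M :: nat pre_matroid) (N :: nat multiset pre_matroid).
      matroid M \<and> matroid N \<and> ground N = Sym 2 (ground M) \<and>
      SP_rank 2 M N \<and> flat_property 2 M N \<and> \<not> multilinearity 2 M N"
    using matroid_parallel_matroid matroid_parallel_product parallel.ground_N parallel_SP_rank
      parallel_flat_property parallel_not_multilinear by blast
qed

end
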